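(* Let $m,n,d\ge 1$ be integers, $q\in(0,2)$, $\lambda>0$, and let $F:\mathbb{R}^{m\times n}\to\mathbb{R}$ be continuously differentiable. For $(U,V)\in\mathbb{R}^{m\times d}\times\mathbb{R}^{n\times d}$ let $$\Phi_\lambda(U,V)=F(UV^T)+\frac{\lambda}{q}\left(\|U\|_{2,q}^q+\|V\|_{2,q}^q\right).$$ Then every critical point of $\Phi_\lambda$ belongs to the set $$\mathcal{E}_\lambda=\left\{(U,V)\in\mathcal{T}(\mathbb{R}^{m\times d})\times\mathcal{T}(\mathbb{R}^{n\times d})\;:\;U^TU=V^TV\right\},$$ where $$\mathcal{T}(\mathbb{R}^{k\times d})=\left\{A\in\mathbb{R}^{k\times d}\;:\;A_{:,i}^TA_{:,j}=0\ \text{ whenever } i\ne j \text{ and } \|A_{:,i}\|_2\ne\|A_{:,j}\|_2\right\}.$$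
   Context: $A_{:,i}$ denotes the $i$-th column of $A$, and $\|A\|_{2,q}^q=\sum_{i}\|A_{:,i}\|_2^q$. The Fréchet subdifferential $\hat\partial\Phi(x)$ is the set of $g$ with $\liminf_{y\to x,\,y\ne x}\frac{\Phi(y)-\Phi(x)-\langle g,y-x\rangle}{\|y-x\|}\ge 0$; the limiting Fréchet subdifferential is $\partial\Phi(x)=\{g:\exists\,x_m\to x,\ g_m\in\hat\partial\Phi(x_m),\ g_m\to g\}$. A point $x$ is a critical point of $\Phi$ if $0\in\partial\Phi(x)$. *)

theory Defs
  imports "HOL-Analysis.Analysis"
begin

text \<open>
  A real \<open>k \<times> l\<close> matrix is an element of \<^typ>\<open>real ^ 'l ^ 'k\<close>; the inner product and norm of this
  type are the Frobenius ones, and those of the product type are the induced ones on pairs.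
\<close>

definition continuously_differentiable ::
    "('a::real_normed_vector \<Rightarrow> 'b::real_normed_vector) \<Rightarrow> bool" where
  "continuously_differentiable f \<longleftrightarrow>
     (\<exists>f' :: 'a \<Rightarrow> 'a \<Rightarrow>\<^sub>L 'b.
        (\<forall>x. (f has_derivative blinfun_apply (f' x)) (at x)) \<and> continuous_on UNIV f')"

definition frechet_subdifferential :: "('a::real_inner \<Rightarrow> real) \<Rightarrow> 'a \<Rightarrow> 'a set" where
  "frechet_subdifferential \<Phi> x =
     {g. Liminf (at x) (\<lambda>y. ereal ((\<Phi> y - \<Phi> x - g \<bullet> (y - x)) / norm (y - x))) \<ge> 0}"

definition limiting_subdifferential :: "('a::real_inner \<Rightarrow> real) \<Rightarrow> 'a \<Rightarrow> 'a set" where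
  "limiting_subdifferential \<Phi> x =
     {g. \<exists>(X :: nat \<Rightarrow> 'a) (G :: nat \<Rightarrow> 'a).
           X \<longlonglongrightarrow> x \<and> (\<forall>k. G k \<in> frechet_subdifferential \<Phi> (X k)) \<and> G \<longlonglongrightarrow> g}"

definition critical_point :: "('a::real_inner \<Rightarrow> real) \<Rightarrow> 'a \<Rightarrow> bool" where
  "critical_point \<Phi> x \<longleftrightarrow> 0 \<in> limiting_subdifferential \<Phi> x"

text \<open>
  The \<open>q\<close>-th power of the \<open>(2,q)\<close>-norm. Zero columns contribute \<open>0\<close>, since \<open>0 powr q = 0\<close>.
\<close>

definition norm_2q_pow :: "real \<Rightarrow> real ^ 'd ^ 'k \<Rightarrow> real" where
  "norm_2q_pow q A = (\<Sum>i\<in>UNIV. norm (column i A) powr q)"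

definition Phi ::
    "real \<Rightarrow> real \<Rightarrow> (real ^ 'n ^ 'm \<Rightarrow> real) \<Rightarrow> (real ^ 'd ^ 'm) \<times> (real ^ 'd ^ 'n) \<Rightarrow> real" where
  "Phi q lam F = (\<lambda>(U, V). F (U ** transpose V) + lam / q * (norm_2q_pow q U + norm_2q_pow q V))"

definition T_set :: "(real ^ 'd ^ 'k) set" where
  "T_set = {A. \<forall>i j. i \<noteq> j \<and> norm (column i A) \<noteq> norm (column j A) \<longrightarrow>
                 column i A \<bullet> column j A = 0}"

text \<open>
  As a set of matrix pairs, \<open>\<E>\<^sub>\<lambda>\<close> does not involve \<open>\<lambda>\<close>, so the parameter is dropped.
\<close>

definition E_set :: "((real ^ 'd ^ 'm) \<times> (real ^ 'd ^ 'n)) set" where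
  "E_set = {(U, V). U \<in> T_set \<and> V \<in> T_set \<and> transpose U ** U = transpose V ** V}"

end

theory Submission
  imports Defs
begin

text \<open>
  In a direction that changes only the nonzero column \<open>u\<^sub>i\<close> of \<open>U\<close>, the function \<open>\<Phi>\<^sub>\<lambda>\<close> is
  differentiable near \<open>(U, V)\<close>, with continuous directional derivative. A limiting subgradient is
  therefore determined in such directions, so with \<open>M = \<nabla>F(UV\<^sup>T)\<close> criticality yields
  \<open>M v\<^sub>i = - \<lambda> \<parallel>u\<^sub>i\<parallel>\<^bsup>q-2\<^esup> u\<^sub>i\<close> when \<open>u\<^sub>i \<noteq> 0\<close>, and likewise
  \<open>M\<^sup>T u\<^sub>j = - \<lambda> \<parallel>v\<^sub>j\<parallel>\<^bsup>q-2\<^esup> v\<^sub>j\<close> when \<open>v\<^sub>j \<noteq> 0\<close>. Hence \<open>u\<^sub>i\<close> and \<open>v\<^sub>i\<close> vanish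
  simultaneously, and evaluating \<open>u\<^sub>j\<^sup>T M v\<^sub>i\<close> in both ways gives
  \<open>\<parallel>u\<^sub>i\<parallel>\<^bsup>q-2\<^esup> u\<^sub>i\<^sup>Tu\<^sub>j = \<parallel>v\<^sub>j\<parallel>\<^bsup>q-2\<^esup> v\<^sub>i\<^sup>Tv\<^sub>j\<close> on the common support.
  The case \<open>i = j\<close> gives \<open>\<parallel>u\<^sub>i\<parallel> = \<parallel>v\<^sub>i\<parallel>\<close>; comparing the equations for \<open>(i, j)\<close> and \<open>(j, i)\<close>,
  together with \<open>q \<noteq> 2\<close>, gives the rest.
\<close>

section \<open>Limiting subgradients and directional derivatives\<close>

lemma frechet_subdifferential_directional_le:
  fixes \<Phi> :: "'a::real_inner \<Rightarrow> real"
  assumes g: "g \<in> frechet_subdifferential \<Phi> x"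
    and D: "((\<lambda>t. \<Phi> (x + t *\<^sub>R h)) has_real_derivative D) (at 0)"
  shows "g \<bullet> h \<le> D"
proof (cases "h = 0")
  case True
  then show ?thesis
    using D DERIV_unique[OF _ DERIV_const] by fastforce
next
  case False
  define Q where "Q y = (\<Phi> y - \<Phi> x - g \<bullet> (y - x)) / norm (y - x)" for y
  have lim: "((\<lambda>t. (\<Phi> (x + t *\<^sub>R h) - \<Phi> x) / t) \<longlongrightarrow> D) (at_right 0)"
    using D by (auto simp: DERIV_def intro: tendsto_within_subset)
  have path: "filterlim (\<lambda>t. x + t *\<^sub>R h) (at x) (at_right 0)"
    unfolding filterlim_at
  proof
    show "\<forall>\<^sub>F t in at_right 0. x + t *\<^sub>R h \<in> UNIV \<and> x + t *\<^sub>R h \<noteq> x"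
      using False by (auto simp: eventually_at_filter)
    have "((\<lambda>t. x + t *\<^sub>R h) \<longlongrightarrow> x + 0 *\<^sub>R h) (at_right 0)"
      by (intro tendsto_intros)
    then show "((\<lambda>t. x + t *\<^sub>R h) \<longlongrightarrow> x) (at_right 0)" by simp
  qed
  \<comment> \<open>The slack \<open>e\<close> turns the bound on the \<open>Liminf\<close> into a
    strict bound that holds eventually; along the ray with \<open>t > 0\<close> the denominator is
    \<open>t * norm h\<close>, so it can be rearranged to a bound on the difference
    quotient.\<close>
  have le: "g \<bullet> h - e * norm h \<le> D" if "e > 0" for e
  proof (rule tendsto_lowerbound[OF lim])
    have "ereal (- e) < Liminf (at x) (\<lambda>y. ereal (Q y))"
      using g that unfolding frechet_subdifferential_def Q_def
      by (auto intro: less_le_trans[of _ 0])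
    then have "\<forall>\<^sub>F y in at x. - e < Q y"
      by (auto dest: less_LiminfD)
    then have "\<forall>\<^sub>F t in at_right 0. - e < Q (x + t *\<^sub>R h)"
      by (rule eventually_compose_filterlim[OF _ path])
    moreover have "\<forall>\<^sub>F t in at_right 0. t > (0::real)"
      by (simp add: eventually_at_right_less)
    ultimately show "\<forall>\<^sub>F t in at_right 0. g \<bullet> h - e * norm h \<le> (\<Phi> (x + t *\<^sub>R h) - \<Phi> x) / t"
    proof eventually_elim
      case (elim t)
      then show ?case
        using False by (simp add: Q_def field_simps)
    qed
  qed simp
  have "g \<bullet> h \<le> D + e" if "e > 0" for e
    using le[of "e / norm h"] that False by simp
  then show ?thesis
    by (rule field_le_epsilon)
qed

text \<open>A two-sided derivative changes sign with the direction, so the one-sided bound for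
  \<open>h\<close> and for \<open>- h\<close> forces equality.\<close>

lemma frechet_subdifferential_directional:
  fixes \<Phi> :: "'a::real_inner \<Rightarrow> real"
  assumes g: "g \<in> frechet_subdifferential \<Phi> x"
    and D: "((\<lambda>t. \<Phi> (x + t *\<^sub>R h)) has_real_derivative D) (at 0)"
  shows "g \<bullet> h = D"
proof (rule antisym)
  show "g \<bullet> h \<le> D"
    by (rule frechet_subdifferential_directional_le[OF assms])
  have "((\<lambda>t. \<Phi> (x + (- t) *\<^sub>R h)) has_real_derivative - D) (at 0)"
    using DERIV_mirror[of "\<lambda>t. \<Phi> (x + t *\<^sub>R h)" D "0::real"] D by simp
  then have "g \<bullet> (- h) \<le> - D"
    by (intro frechet_subdifferential_directional_le[OF g]) simp
  then show "D \<le> g \<bullet> h" by simp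
qed

text \<open>The Frechet subgradients at nearby points have inner product \<open>D (X k)\<close> with
  \<open>h\<close>, and continuity of \<open>D\<close> carries this to the limit. Only smoothness
  along \<open>h\<close> enters, so it applies to \<open>Phi\<close> even where other columns
  vanish.\<close>

lemma limiting_subdifferential_directional:
  fixes \<Phi> :: "'a::real_inner \<Rightarrow> real"
  assumes g: "g \<in> limiting_subdifferential \<Phi> x"
    and D: "\<forall>\<^sub>F y in nhds x. ((\<lambda>t. \<Phi> (y + t *\<^sub>R h)) has_real_derivative D y) (at 0)"
    and cont: "isCont D x"
  shows "g \<bullet> h = D x"
proof -
  obtain X G where X: "X \<longlonglongrightarrow> x" and G: "G \<longlonglongrightarrow> g"
    and sub: "\<And>k. G k \<in> frechet_subdifferential \<Phi> (X k)"
    using g unfolding limiting_subdifferential_def by blast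
  have "\<forall>\<^sub>F k in sequentially. G k \<bullet> h = D (X k)"
    using eventually_compose_filterlim[OF D X]
    by eventually_elim (rule frechet_subdifferential_directional[OF sub])
  moreover have "(\<lambda>k. D (X k)) \<longlonglongrightarrow> D x"
    by (rule isCont_tendsto_compose[OF cont X])
  ultimately have "(\<lambda>k. G k \<bullet> h) \<longlonglongrightarrow> D x"
    by (simp add: tendsto_cong)
  moreover have "(\<lambda>k. G k \<bullet> h) \<longlonglongrightarrow> g \<bullet> h"
    by (intro tendsto_intros G)
  ultimately show ?thesis
    by (rule LIMSEQ_unique[rotated])
qed

section \<open>Rank-one matrices and single-column directions\<close>

definition outer :: "real ^ 'm \<Rightarrow> real ^ 'n \<Rightarrow> real ^ 'n ^ 'm" where
  "outer u v = (\<chi> a b. u $ a * v $ b)"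

lemma outer_0_left [simp]: "outer 0 v = 0" and outer_0_right [simp]: "outer u 0 = 0"
  by (simp_all add: outer_def vec_eq_iff)

lemma continuous_outer [continuous_intros]:
  "continuous F f \<Longrightarrow> continuous F g \<Longrightarrow> continuous F (\<lambda>x. outer (f x) (g x))"
  unfolding outer_def continuous_def by (intro tendsto_intros tendsto_vec_lambda)

text \<open>The left factor has \<open>w\<close> in column \<open>i\<close> and zeros elsewhere, so
  it meets only column \<open>i\<close> of \<open>B\<close>. This gives the change of the product
  when one column of the left factor moves.\<close>

lemma outer_axis_mult_transpose:
  fixes B :: "real ^ 'd ^ 'n"
  shows "outer w (axis i 1) ** transpose B = outer w (column i B)"
  by (simp add: vec_eq_iff outer_def matrix_matrix_mult_def transpose_def column_def axis_def
      if_distrib[of "\<lambda>x. _ * x"] if_distrib[of "\<lambda>x. x * _"] cong: if_cong)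

lemma mult_transpose_outer_axis:
  fixes A :: "real ^ 'd ^ 'm"
  shows "A ** transpose (outer w (axis i 1)) = outer (column i A) w"
  by (simp add: vec_eq_iff outer_def matrix_matrix_mult_def transpose_def column_def axis_def
      if_distrib[of "\<lambda>x. _ * x"] if_distrib[of "\<lambda>x. x * _"] cong: if_cong)

lemma column_add_outer_axis:
  fixes A :: "real ^ 'd ^ 'k"
  shows "column k (A + t *\<^sub>R outer w (axis i 1)) = column k A + (if k = i then t *\<^sub>R w else 0)"
  by (simp add: vec_eq_iff outer_def column_def axis_def)

lemma continuous_column [continuous_intros]:
  fixes f :: "'a::t2_space \<Rightarrow> real ^ 'd ^ 'k"
  shows "continuous F f \<Longrightarrow> continuous F (\<lambda>x. column i (f x))"
  unfolding column_def continuous_def by (intro tendsto_intros tendsto_vec_lambda)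

lemma continuous_mult_transpose [continuous_intros]:
  fixes f :: "'a::t2_space \<Rightarrow> real ^ 'd ^ 'm" and g :: "'a \<Rightarrow> real ^ 'd ^ 'n"
  shows "continuous F f \<Longrightarrow> continuous F g \<Longrightarrow> continuous F (\<lambda>x. f x ** transpose (g x))"
  unfolding matrix_matrix_mult_def transpose_def continuous_def
  by (auto intro!: tendsto_intros tendsto_vec_lambda)

section \<open>Derivatives of norm powers and of \<open>Phi\<close> along single-column
  directions\<close>

lemma powr_inject_base:
  fixes a b q :: real
  assumes "a powr q = b powr q" and "q \<noteq> 0" and "0 < a" and "0 < b"
  shows "a = b"
  using arg_cong[OF assms(1), of "\<lambda>c. c powr (1 / q)"] assms(2-4) by (simp add: powr_powr)

text \<open>The power is \<open>(norm ^ 2) powr (q / 2)\<close>, whose base is a polynomial in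
  \<open>t\<close> that is positive at \<open>t = 0\<close>.\<close>

lemma norm_powr_has_derivative_line:
  fixes a w :: "'a::real_inner"
  assumes "a \<noteq> 0"
  shows "((\<lambda>t. norm (a + t *\<^sub>R w) powr q) has_real_derivative
           q * norm a powr (q - 2) * (a \<bullet> w)) (at 0)"
proof -
  have eq: "norm (a + t *\<^sub>R w) powr q = ((a + t *\<^sub>R w) \<bullet> (a + t *\<^sub>R w)) powr (q / 2)" for t
    by (simp add: dot_square_norm powr_powr flip: powr_numeral)
  have "((\<lambda>t. ((a + t *\<^sub>R w) \<bullet> (a + t *\<^sub>R w))) has_real_derivative 2 * (a \<bullet> w)) (at 0)"
    unfolding has_field_derivative_def
    by (auto intro!: derivative_eq_intros simp: inner_commute fun_eq_iff algebra_simps)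
  then have "((\<lambda>t. ((a + t *\<^sub>R w) \<bullet> (a + t *\<^sub>R w)) powr (q / 2)) has_real_derivative
      q / 2 * (a \<bullet> a) powr (q / 2 - 1) * (2 * (a \<bullet> w))) (at 0)"
    using assms DERIV_fun_powr[of "\<lambda>t. (a + t *\<^sub>R w) \<bullet> (a + t *\<^sub>R w)" "2 * (a \<bullet> w)" 0 "q / 2"]
    by simp
  moreover have "(a \<bullet> a) powr (q / 2 - 1) = norm a powr (q - 2)"
    by (simp add: dot_square_norm powr_powr algebra_simps flip: powr_numeral)
  ultimately show ?thesis
    by (simp add: eq mult.assoc)
qed

text \<open>Only the summand of column \<open>i\<close> varies with \<open>t\<close>; the others are
  constant, even where a column is zero.\<close>

lemma norm_2q_pow_has_derivative_column:
  fixes A :: "real ^ 'd ^ 'k"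
  assumes "column i A \<noteq> 0"
  shows "((\<lambda>t. norm_2q_pow q (A + t *\<^sub>R outer w (axis i 1))) has_real_derivative
           q * norm (column i A) powr (q - 2) * (column i A \<bullet> w)) (at 0)"
proof -
  have "((\<lambda>t. norm (column k (A + t *\<^sub>R outer w (axis i 1))) powr q) has_real_derivative
      (if k = i then q * norm (column i A) powr (q - 2) * (column i A \<bullet> w) else 0)) (at 0)" for k
    using norm_powr_has_derivative_line[OF assms] by (simp add: column_add_outer_axis)
  then have "((\<lambda>t. norm_2q_pow q (A + t *\<^sub>R outer w (axis i 1))) has_real_derivative
      (\<Sum>k\<in>UNIV. if k = i then q * norm (column i A) powr (q - 2) * (column i A \<bullet> w) else 0)) (at 0)"
    unfolding norm_2q_pow_def by (rule DERIV_sum)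
  then show ?thesis by simp
qed

lemma has_derivative_along_line:
  assumes "(F has_derivative F') (at (x::'a::real_normed_vector))"
  shows "((\<lambda>t. F (x + t *\<^sub>R h)) has_real_derivative F' h) (at 0)"
proof -
  have "((\<lambda>t. x + t *\<^sub>R h) has_derivative (\<lambda>t. t *\<^sub>R h)) (at 0)"
    by (auto intro!: derivative_eq_intros)
  moreover have "(F has_derivative F') (at (x + 0 *\<^sub>R h))"
    using assms by simp
  ultimately have "((\<lambda>t. F (x + t *\<^sub>R h)) has_derivative (\<lambda>t. F' (t *\<^sub>R h))) (at 0)"
    by (rule has_derivative_compose)
  moreover have "F' (t *\<^sub>R h) = F' h * t" for t
    using linear_scale[OF has_derivative_linear[OF assms]] by simp
  ultimately show ?thesis
    by (simp add: has_field_derivative_def)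
qed

text \<open>With \<open>B\<close> fixed the product is affine in \<open>t\<close>, so the first term
  is \<open>F\<close> along a line; the factor \<open>q\<close> from the norm power cancels against
  \<open>lam / q\<close>.\<close>

lemma Phi_has_derivative_left_column:
  fixes A :: "real ^ 'd ^ 'm" and B :: "real ^ 'd ^ 'n"
  assumes "(F has_derivative F') (at (A ** transpose B))" and "q \<noteq> 0" and "column i A \<noteq> 0"
  shows "((\<lambda>t. Phi q lam F ((A, B) + t *\<^sub>R (outer w (axis i 1), 0))) has_real_derivative
           F' (outer w (column i B)) + lam * norm (column i A) powr (q - 2) * (column i A \<bullet> w))
         (at 0)"
proof -
  note reg = norm_2q_pow_has_derivative_column[OF assms(3), of q w]
  have "(A + t *\<^sub>R W) ** transpose B = A ** transpose B + t *\<^sub>R (W ** transpose B)" for t W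
    by (simp add: vec_eq_iff matrix_matrix_mult_def sum.distrib sum_distrib_left algebra_simps)
  then show ?thesis
    unfolding Phi_def
    using DERIV_add[OF has_derivative_along_line[OF assms(1), of "outer w (column i B)"]
        DERIV_cmult[OF DERIV_add[OF reg DERIV_const[of "norm_2q_pow q B"]], of "lam / q"]] assms(2)
    by (simp add: outer_axis_mult_transpose mult.assoc)
qed

lemma Phi_has_derivative_right_column:
  fixes A :: "real ^ 'd ^ 'm" and B :: "real ^ 'd ^ 'n"
  assumes "(F has_derivative F') (at (A ** transpose B))" and "q \<noteq> 0" and "column i B \<noteq> 0"
  shows "((\<lambda>t. Phi q lam F ((A, B) + t *\<^sub>R (0, outer w (axis i 1)))) has_real_derivative
           F' (outer (column i A) w) + lam * norm (column i B) powr (q - 2) * (column i B \<bullet> w))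
         (at 0)"
proof -
  note reg = norm_2q_pow_has_derivative_column[OF assms(3), of q w]
  have "A ** transpose (B + t *\<^sub>R W) = A ** transpose B + t *\<^sub>R (A ** transpose W)" for t W
    by (simp add: vec_eq_iff matrix_matrix_mult_def transpose_def sum.distrib sum_distrib_left
        algebra_simps)
  then show ?thesis
    unfolding Phi_def
    using DERIV_add[OF has_derivative_along_line[OF assms(1), of "outer (column i A) w"]
        DERIV_cmult[OF DERIV_add[OF DERIV_const[of "norm_2q_pow q A"] reg], of "lam / q"]] assms(2)
    by (simp add: mult_transpose_outer_axis mult.assoc)
qed

section \<open>Column equations at a critical point\<close>

lemma eventually_column_nonzero:
  fixes f :: "'a::t2_space \<Rightarrow> real ^ 'd ^ 'k"
  assumes "isCont f x" and "column i (f x) \<noteq> 0"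
  shows "\<forall>\<^sub>F y in nhds x. column i (f y) \<noteq> 0"
proof -
  have "isCont (\<lambda>y. column i (f y)) x"
    by (intro continuous_intros assms)
  then have "((\<lambda>y. column i (f y)) \<longlongrightarrow> column i (f x)) (nhds x)"
    unfolding isCont_def by (rule tendsto_at_iff_tendsto_nhds[THEN iffD1])
  then show ?thesis
    using assms(2) by (rule tendsto_imp_eventually_ne)
qed

text \<open>Weak form of the equation for \<open>M v_i\<close>, tested against an arbitrary
  \<open>w\<close>: the derivative of \<open>F\<close> at a rank-one matrix is
  \<open>w \<bullet> (M v_i)\<close>.\<close>

lemma critical_point_left_column:
  fixes U :: "real ^ 'd ^ 'm" and V :: "real ^ 'd ^ 'n"
  assumes deriv: "\<And>x. (F has_derivative blinfun_apply (F' x)) (at x)"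
    and cont: "continuous_on UNIV F'"
    and crit: "critical_point (Phi q lam F) (U, V)" and "q \<noteq> 0" and U: "column i U \<noteq> 0"
  shows "F' (U ** transpose V) (outer w (column i V)) =
           - lam * norm (column i U) powr (q - 2) * (column i U \<bullet> w)"
proof -
  define D where "D = (\<lambda>y. F' (fst y ** transpose (snd y)) (outer w (column i (snd y)))
      + lam * norm (column i (fst y)) powr (q - 2) * (column i (fst y) \<bullet> w))"
  have F': "isCont F' x" for x
    using cont by (simp add: continuous_on_eq_continuous_at)
  have "(0 :: (real ^ 'd ^ 'm) \<times> (real ^ 'd ^ 'n)) \<bullet> (outer w (axis i 1), 0) = D (U, V)"
  proof (rule limiting_subdifferential_directional)
    show "0 \<in> limiting_subdifferential (Phi q lam F) (U, V)"
      using crit by (simp add: critical_point_def)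
    show "isCont D (U, V)"
      unfolding D_def using U
      by (auto intro!: continuous_intros blinfun.continuous isCont_o2[OF _ F'])
    \<comment> \<open>Being nonzero is an open condition, so the derivative formula holds at all
      nearby pairs.\<close>
    have "\<forall>\<^sub>F y in nhds (U, V). column i (fst y) \<noteq> 0"
      by (rule eventually_column_nonzero) (auto intro!: continuous_intros simp: U)
    then show "\<forall>\<^sub>F y in nhds (U, V). ((\<lambda>t. Phi q lam F (y + t *\<^sub>R (outer w (axis i 1), 0)))
        has_real_derivative D y) (at 0)"
    proof eventually_elim
      case (elim y)
      then show ?case
        using Phi_has_derivative_left_column[OF deriv \<open>q \<noteq> 0\<close>,
            where A = "fst y" and B = "snd y" and i = i]
        by (simp add: D_def)
    qed
  qed
  then show ?thesis
    by (simp add: D_def)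
qed

lemma critical_point_right_column:
  fixes U :: "real ^ 'd ^ 'm" and V :: "real ^ 'd ^ 'n"
  assumes deriv: "\<And>x. (F has_derivative blinfun_apply (F' x)) (at x)"
    and cont: "continuous_on UNIV F'"
    and crit: "critical_point (Phi q lam F) (U, V)" and "q \<noteq> 0" and V: "column i V \<noteq> 0"
  shows "F' (U ** transpose V) (outer (column i U) w) =
           - lam * norm (column i V) powr (q - 2) * (column i V \<bullet> w)"
proof -
  define D where "D = (\<lambda>y. F' (fst y ** transpose (snd y)) (outer (column i (fst y)) w)
      + lam * norm (column i (snd y)) powr (q - 2) * (column i (snd y) \<bullet> w))"
  have F': "isCont F' x" for x
    using cont by (simp add: continuous_on_eq_continuous_at)
  have "(0 :: (real ^ 'd ^ 'm) \<times> (real ^ 'd ^ 'n)) \<bullet> (0, outer w (axis i 1)) = D (U, V)"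
  proof (rule limiting_subdifferential_directional)
    show "0 \<in> limiting_subdifferential (Phi q lam F) (U, V)"
      using crit by (simp add: critical_point_def)
    show "isCont D (U, V)"
      unfolding D_def using V
      by (auto intro!: continuous_intros blinfun.continuous isCont_o2[OF _ F'])
    have "\<forall>\<^sub>F y in nhds (U, V). column i (snd y) \<noteq> 0"
      by (rule eventually_column_nonzero) (auto intro!: continuous_intros simp: V)
    then show "\<forall>\<^sub>F y in nhds (U, V). ((\<lambda>t. Phi q lam F (y + t *\<^sub>R (0, outer w (axis i 1))))
        has_real_derivative D y) (at 0)"
    proof eventually_elim
      case (elim y)
      then show ?case
        using Phi_has_derivative_right_column[OF deriv \<open>q \<noteq> 0\<close>,
            where A = "fst y" and B = "snd y" and i = i]
        by (simp add: D_def)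
    qed
  qed
  then show ?thesis
    by (simp add: D_def)
qed

lemma transpose_mult_self_component:
  fixes A :: "real ^ 'd ^ 'k"
  shows "(transpose A ** A) $ i $ j = column i A \<bullet> column j A"
  by (simp add: matrix_matrix_mult_def transpose_def column_def inner_vec_def)

theorem theorem3p1:
  fixes F :: "real ^ 'n ^ 'm \<Rightarrow> real"
    and U :: "real ^ 'd ^ 'm" and V :: "real ^ 'd ^ 'n"
    and q lam :: real
  assumes "0 < q" and "q < 2" and "0 < lam"
    and "continuously_differentiable F"
    and "critical_point (Phi q lam F) (U, V)"
  shows "(U, V) \<in> E_set"
proof -
  obtain F' where deriv: "\<And>x. (F has_derivative blinfun_apply (F' x)) (at x)"
    and cont: "continuous_on UNIV F'"
    using assms(4) unfolding continuously_differentiable_def by blast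
  define u v where "u i = column i U" and "v i = column i V" for i
  have q: "q \<noteq> 0" using assms(1) by simp
  note left = critical_point_left_column[OF deriv cont assms(5) q, folded u_def v_def]
  note right = critical_point_right_column[OF deriv cont assms(5) q, folded u_def v_def]
  \<comment> \<open>If exactly one of the two columns vanished, testing its partner's equation with
    the partner itself would equate 0 with a nonzero number.\<close>
  have zero: "u i = 0 \<longleftrightarrow> v i = 0" for i
    using left[of i "u i"] right[of i "v i"] assms(3)
    by (cases "u i = 0"; cases "v i = 0") (auto simp: blinfun.zero_right)
  \<comment> \<open>Both equations evaluate the derivative of \<open>F\<close> at the same matrix
    \<open>outer (u j) (v i)\<close>.\<close>
  have mixed: "norm (u i) powr (q - 2) * (u i \<bullet> u j) = norm (v j) powr (q - 2) * (v i \<bullet> v j)"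
    if "u i \<noteq> 0" "u j \<noteq> 0" for i j
    using left[of i "u j"] right[of j "v i"] that zero[of j] assms(3)
    by (simp add: inner_commute)
  have norms: "norm (u i) = norm (v i)" for i
  proof (cases "u i = 0")
    case False
    have *: "norm a powr (q - 2) * (a \<bullet> a) = norm a powr q" if "a \<noteq> 0" for a :: "real ^ 'k"
      using that by (simp add: dot_square_norm flip: powr_add powr_numeral)
    have "norm (u i) powr q = norm (v i) powr q"
      using mixed[OF False False] False zero[of i] * by metis
    then show ?thesis
      using powr_inject_base[OF _ q] False zero[of i] by simp
  qed (use zero in simp)
  have key: "u i \<bullet> u j = v i \<bullet> v j \<and> (norm (u i) \<noteq> norm (u j) \<longrightarrow> u i \<bullet> u j = 0)" for i j
  proof (cases "u i = 0 \<or> u j = 0")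
    case True
    then show ?thesis using zero[of i] zero[of j] by auto
  next
    case False
    define a b where "a = norm (u i) powr (q - 2)" and "b = norm (u j) powr (q - 2)"
    have pos: "a > 0" "b > 0"
      using False by (simp_all add: a_def b_def)
    \<comment> \<open>By \<open>norms\<close>, the weights of the \<open>v\<close> columns are also
      \<open>a\<close> and \<open>b\<close>; swapping \<open>i\<close> and \<open>j\<close> swaps
      the weights. Adding the two equations gives the factor \<open>a + b > 0\<close>.\<close>
    have 1: "a * (u i \<bullet> u j) = b * (v i \<bullet> v j)" and 2: "b * (u i \<bullet> u j) = a * (v i \<bullet> v j)"
      using mixed[of i j] mixed[of j i] False norms
      by (simp_all add: a_def b_def inner_commute)
    have "(a + b) * (u i \<bullet> u j - v i \<bullet> v j) = 0"
      using 1 2 by (simp add: algebra_simps)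
    then have eq: "u i \<bullet> u j = v i \<bullet> v j"
      using pos by simp
    moreover have "u i \<bullet> u j = 0" if "norm (u i) \<noteq> norm (u j)"
    proof -
      \<comment> \<open>Since \<open>q - 2\<close> is nonzero, different norms give different
        weights; then \<open>1\<close> and \<open>eq\<close> leave
        \<open>(a - b) * (u i \<bullet> u j) = 0\<close>.\<close>
      have "a \<noteq> b"
        using that False assms(2) powr_inject_base[of "norm (u i)" "q - 2" "norm (u j)"]
        by (auto simp: a_def b_def)
      then show ?thesis
        using 1 eq by simp
    qed
    ultimately show ?thesis by simp
  qed
  have "transpose U ** U = transpose V ** V"
    using key by (simp add: vec_eq_iff transpose_mult_self_component u_def v_def)
  moreover have "U \<in> T_set"
    using key unfolding T_set_def u_def v_def by blast
  moreover have "norm (v i) \<noteq> norm (v j) \<longrightarrow> v i \<bullet> v j = 0" for i j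
    using key[of i j] norms by auto
  then have "V \<in> T_set"
    by (auto simp: T_set_def v_def)
  ultimately show ?thesis
    by (simp add: E_set_def)
qed

end
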